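(* Let $\lambda$ be the unique real root of $\lambda^3-\lambda^2-\lambda-1=0$, and let $F^0(x)=\lim_{n\to\infty}F^0_n(x)$, $x\in[0,1]$, be the limit distribution function associated with odd continued fractions with zero integer part. For all $x\in[0,1]$ and all integers $n\ge1$, $$\frac{F^0(x)}{\lambda^{2n-1}}=\frac{1}{\lambda^{2n-2}}-F^0\left(\frac{1}{2n-1+x}\right),$$ $$\frac{F^0(x)}{\lambda^{2n}}=F^0\left(\frac{1}{2n+\frac1x}\right),$$ where for $x=0$ the expression $\frac{1}{2n+1/x}$ is read as $0$.
   Context: Every rational $x\in[0,1]$ is written uniquely as $$x=\left[0;\frac{\varepsilon_1}{a_1},\ldots,\frac{\varepsilon_l}{a_l}\right]=\cfrac{\varepsilon_1}{a_1+\cfrac{\varepsilon_2}{a_2+\cdots+\cfrac{\varepsilon_l}{a_l}}},$$ where all $a_i$ are odd positive integers, $\varepsilon_i\in\{1,-1\}$, $\varepsilon_1=1$, and $a_j+\varepsilon_{j+1}\ge2$ for $1\le j<l$; moreover, if the last partial quotient is $a_l=1$, then $\varepsilon_l=1$. (The number $0$ has $l=0$, and $1=\left[0;\frac11\right]$.) For rational $x\in[0,1]$ put $S^0(x)=\sum_{j=1}^l a_j$. For $n\ge1$ let $\mathcal{Y}_n=\{x\in\mathbb{Q}\cap[0,1]:S^0(x)\le n+1\}$, which is a finite set, and $$F^0_n(x)=\frac{\#\{\xi\in\mathcal{Y}_n:\xi\le x\}}{\#\mathcal{Y}_n},\qquad x\in[0,1].$$ The limit $F^0(x)=\lim_{n\to\infty}F^0_n(x)$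 exists for every $x\in[0,1]$. *)

theory Defs
  imports Complex_Main
begin

text \<open>The list \<open>[(\<epsilon>\<^sub>1, a\<^sub>1), \<dots>, (\<epsilon>\<^sub>l, a\<^sub>l)]\<close> stands for \<open>[0; \<epsilon>\<^sub>1/a\<^sub>1, \<dots>, \<epsilon>\<^sub>l/a\<^sub>l]\<close>.\<close>

fun cf_value :: "(int \<times> nat) list \<Rightarrow> real" where
  "cf_value [] = 0"
| "cf_value ((e, a) # cs) = of_int e / (of_nat a + cf_value cs)"

definition odd_cf :: "(int \<times> nat) list \<Rightarrow> bool" where
  "odd_cf cs \<longleftrightarrow>
     (\<forall>(e, a) \<in> set cs. odd a \<and> e \<in> {1, -1}) \<and>
     (cs \<noteq> [] \<longrightarrow> fst (hd cs) = 1) \<and>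
     (\<forall>j. Suc j < length cs \<longrightarrow> int (snd (cs ! j)) + fst (cs ! Suc j) \<ge> 2) \<and>
     (cs \<noteq> [] \<and> snd (last cs) = 1 \<longrightarrow> fst (last cs) = 1)"

text \<open>Meaningful for rational \<open>x \<in> [0,1]\<close>, where the expansion exists and is unique.\<close>

definition odd_cf_of :: "real \<Rightarrow> (int \<times> nat) list" where
  "odd_cf_of x = (THE cs. odd_cf cs \<and> cf_value cs = x)"

definition S0 :: "real \<Rightarrow> nat" where
  "S0 x = sum_list (map snd (odd_cf_of x))"

definition Y :: "nat \<Rightarrow> real set" where
  "Y n = {x \<in> \<rat> \<inter> {0..1}. S0 x \<le> n + 1}"

definition F0_seq :: "nat \<Rightarrow> real \<Rightarrow> real" where
  "F0_seq n x = real (card {\<xi> \<in> Y n. \<xi> \<le> x}) / real (card (Y n))"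

definition F0 :: "real \<Rightarrow> real" where
  "F0 x = lim (\<lambda>n. F0_seq n x)"

definition lam :: real where
  "lam = (THE r. r ^ 3 - r ^ 2 - r - 1 = 0)"

end

theory Submission
  imports Defs
begin

text \<open>
  The maps \<open>1 / (1 + x)\<close>, \<open>x / (1 + 2 x)\<close> and \<open>1 / (3 - x)\<close> send \<open>[0, 1]\<close> onto \<open>[1/2, 1]\<close>,
  \<open>[0, 1/3]\<close> and \<open>[1/3, 1/2]\<close> and raise \<open>S\<^sup>0\<close> by 1, 2 and 3 (away from some endpoints). Hence the
  number of rationals in \<open>(0, 1]\<close> with \<open>S\<^sup>0 \<le> m\<close> satisfies the tribonacci recurrence and grows like
  \<open>K \<lambda>\<^sup>m\<close>. The number of those in \<open>(0, x]\<close>, divided by \<open>\<lambda>\<^sup>m\<close>, transforms under the three maps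
  by affine relations whose factors have modulus at most \<open>1/\<lambda>\<close>; iterating them shows that this
  quotient is arbitrarily close to a convergent sequence, so \<open>F\<^sup>0\<close> exists. In the limit the first two
  relations read \<open>F\<^sup>0(1 / (1 + x)) = 1 - F\<^sup>0(x) / \<lambda>\<close> and \<open>F\<^sup>0(x / (1 + 2 x)) = F\<^sup>0(x) / \<lambda>\<^sup>2\<close>, and
  iterating the second one gives both claims.
\<close>

section \<open>Odd continued fraction expansions\<close>

text \<open>The tail after a partial quotient may start with sign \<open>-1\<close>; flipping that sign makes it
  an odd expansion again, of the negated value.\<close>

fun flip_hd :: "(int \<times> nat) list \<Rightarrow> (int \<times> nat) list" where
  "flip_hd [] = []"
| "flip_hd ((e, a) # cs) = (- e, a) # cs"

lemma cf_value_flip_hd [simp]: "cf_value (flip_hd cs) = - cf_value cs"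
  by (cases cs rule: flip_hd.cases) simp_all

lemma length_flip_hd [simp]: "length (flip_hd cs) = length cs"
  by (cases cs rule: flip_hd.cases) simp_all

lemma flip_hd_flip_hd [simp]: "flip_hd (flip_hd cs) = cs"
  by (cases cs rule: flip_hd.cases) simp_all

lemma map_snd_flip_hd [simp]: "map snd (flip_hd cs) = map snd cs"
  by (cases cs rule: flip_hd.cases) simp_all

lemma flip_hd_eq_Nil [simp]: "flip_hd cs = [] \<longleftrightarrow> cs = []"
  by (cases cs rule: flip_hd.cases) simp_all

lemma odd_cf_Nil [simp]: "odd_cf []"
  by (simp add: odd_cf_def)

text \<open>If the next sign is -1, then \<open>a\<close> plus that sign being at least 2, together
  with the oddness of \<open>a\<close>, forces \<open>a \<ge> 3\<close>. Flipping that sign respects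
  every condition on the tail except the one on a last partial quotient 1; hence the excluded tail
  \<open>[(-1, 1)]\<close>.\<close>

lemma odd_cf_Cons:
  "odd_cf ((e, a) # cs) \<longleftrightarrow>
     e = 1 \<and> odd a \<and> (odd_cf cs \<or> 3 \<le> a \<and> odd_cf (flip_hd cs) \<and> cs \<noteq> [(-1, 1)])"
proof (cases cs rule: flip_hd.cases)
  case 1
  then show ?thesis by (auto simp: odd_cf_def)
next
  case (2 f b ds)
  have shift: "(\<forall>j. Suc j < length ((e, a) # (f, b) # ds) \<longrightarrow>
        int (snd (((e, a) # (f, b) # ds) ! j)) + fst (((e, a) # (f, b) # ds) ! Suc j) \<ge> 2)
    \<longleftrightarrow> int a + f \<ge> 2 \<and> (\<forall>j. Suc j < length ((f, b) # ds) \<longrightarrow>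
        int (snd (((f, b) # ds) ! j)) + fst (((f, b) # ds) ! Suc j) \<ge> 2)"
    (is "(\<forall>j. ?P j) \<longleftrightarrow> ?Q \<and> (\<forall>j. ?R j)")
  proof
    assume P: "\<forall>j. ?P j"
    show "?Q \<and> (\<forall>j. ?R j)"
      using spec[OF P, of 0] spec[OF P, of "Suc _"] by auto
  next
    assume QR: "?Q \<and> (\<forall>j. ?R j)"
    show "\<forall>j. ?P j"
    proof
      fix j show "?P j" using QR by (cases j) auto
    qed
  qed
  have flip: "(\<forall>j. Suc j < length ((- f, b) # ds) \<longrightarrow>
        int (snd (((- f, b) # ds) ! j)) + fst (((- f, b) # ds) ! Suc j) \<ge> 2)
    \<longleftrightarrow> (\<forall>j. Suc j < length ((f, b) # ds) \<longrightarrow>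
        int (snd (((f, b) # ds) ! j)) + fst (((f, b) # ds) ! Suc j) \<ge> 2)"
    by (intro all_cong1 imp_cong refl) (auto simp: nth_Cons split: nat.split)
  have a1: "odd a \<Longrightarrow> f = 1 \<Longrightarrow> int a + f \<ge> 2"
    using odd_pos[of a] by linarith
  have a3: "odd a \<Longrightarrow> f = - 1 \<Longrightarrow> int a + f \<ge> 2 \<longleftrightarrow> 3 \<le> a"
    by linarith
  \<comment> \<open>These three conditions do not change when the head sign is flipped; naming them
    leaves an almost propositional goal.\<close>
  define C where "C \<longleftrightarrow> (\<forall>j. Suc j < length ((f, b) # ds) \<longrightarrow>
      int (snd (((f, b) # ds) ! j)) + fst (((f, b) # ds) ! Suc j) \<ge> 2)"
  define D where "D \<longleftrightarrow> (\<forall>(e, a) \<in> set ds. odd a \<and> e \<in> {1, -1})"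
  define E where "E \<longleftrightarrow> (snd (last ds) = 1 \<longrightarrow> fst (last ds) = 1)"
  have cons: "(\<forall>(e, a) \<in> set (x # xs). odd a \<and> e \<in> {1, -1}) \<longleftrightarrow>
      (odd (snd x) \<and> fst x \<in> {1, -1}) \<and> (\<forall>(e, a) \<in> set xs. odd a \<and> e \<in> {1, -1})"
    for x :: "int \<times> nat" and xs by (auto simp: split_beta)
  consider "f = 1" | "f = - 1" | "f \<noteq> 1" "f \<noteq> - 1" by blast
  then show ?thesis
    unfolding 2 flip_hd.simps odd_cf_def shift flip C_def[symmetric] cons D_def[symmetric]
    by cases (use a1 a3 in \<open>cases "ds = []"; simp add: E_def[symmetric]; blast\<close>)+
qed

text \<open>By induction on the length, the denominator \<open>a + cf_value r\<close> is at least 1: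
  either the tail value is nonnegative, or \<open>a \<ge> 3\<close> and the tail value exceeds -1
  because the flipped tail is not \<open>[(1, 1)]\<close>. Equality needs \<open>a = 1\<close> and
  an empty tail.\<close>

lemma cf_value_odd_cf:
  assumes "odd_cf cs"
  shows "0 \<le> cf_value cs" "cf_value cs \<le> 1" "cs \<noteq> [] \<Longrightarrow> 0 < cf_value cs"
    "cs \<noteq> [(1, 1)] \<Longrightarrow> cf_value cs < 1"
proof -
  have "0 \<le> cf_value cs \<and> cf_value cs \<le> 1 \<and> (cs \<noteq> [] \<longrightarrow> 0 < cf_value cs) \<and>
      (cs \<noteq> [(1, 1)] \<longrightarrow> cf_value cs < 1)"
    using assms
  proof (induction "length cs" arbitrary: cs rule: less_induct)
    case less
    show ?case
    proof (cases cs rule: flip_hd.cases)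
      case 1
      then show ?thesis by simp
    next
      case (2 e a r)
      have e: "e = 1" and a: "odd a"
        and d: "odd_cf r \<or> 3 \<le> a \<and> odd_cf (flip_hd r) \<and> r \<noteq> [(-1, 1)]"
        using less.prems odd_cf_Cons 2 by auto
      have a1: "real a \<ge> 1" using odd_pos[OF a] by linarith
      have "a + cf_value r \<ge> 1 \<and> (cs \<noteq> [(1, 1)] \<longrightarrow> a + cf_value r > 1)"
        using d
      proof
        assume "odd_cf r"
        then have IH: "0 \<le> cf_value r" "r \<noteq> [] \<Longrightarrow> 0 < cf_value r"
          using less.hyps[of r] 2 by auto
        show ?thesis
        proof (cases "a = 1 \<and> r = []")
          case False
          then have "real a > 1 \<or> cf_value r > 0" using IH(2) a1 by (cases "a = 1") auto
          then show ?thesis using IH a1 by auto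
        qed (use 2 e in auto)
      next
        assume *: "3 \<le> a \<and> odd_cf (flip_hd r) \<and> r \<noteq> [(-1, 1)]"
        then have "flip_hd r \<noteq> [(1, 1)]" by (cases r rule: flip_hd.cases) auto
        then have "- cf_value r < 1" using less.hyps[of "flip_hd r"] * 2 by auto
        moreover have "real a \<ge> 3" using * by linarith
        ultimately show ?thesis by auto
      qed
      then show ?thesis using 2 e by (auto simp: divide_le_eq)
    qed
  qed
  then show "0 \<le> cf_value cs" "cf_value cs \<le> 1" "cs \<noteq> [] \<Longrightarrow> 0 < cf_value cs"
    "cs \<noteq> [(1, 1)] \<Longrightarrow> cf_value cs < 1" by auto
qed

text \<open>Either way the tail value lies in (-1, 1], and for a nonempty tail its sign tells the
  two cases apart. The bound -1 is strict because the tail \<open>[(-1, 1)]\<close> is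
  excluded.\<close>

lemma odd_cf_tail:
  assumes "odd_cf ((e, a) # r)"
  obtains "odd_cf r" "0 \<le> cf_value r" "cf_value r \<le> 1" "r \<noteq> [] \<Longrightarrow> 0 < cf_value r"
  | "odd_cf (flip_hd r)" "- 1 < cf_value r" "cf_value r \<le> 0" "r \<noteq> [] \<Longrightarrow> cf_value r < 0"
proof (cases "odd_cf r")
  case True
  then show ?thesis using that(1) cf_value_odd_cf[OF True] by auto
next
  case False
  then have *: "odd_cf (flip_hd r)" "r \<noteq> [(-1, 1)]" using assms odd_cf_Cons by auto
  have "flip_hd r \<noteq> [(1, 1)]" using * by (cases r rule: flip_hd.cases) auto
  then show ?thesis using that(2) * cf_value_odd_cf[OF *(1)] by auto
qed

text \<open>Tail values lie in (-1, 1], so the leading quotients differ by less than 2 and, being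
  odd, agree. The tails then have equal values, and the induction hypothesis applies to them or to
  their flipped forms.\<close>

lemma odd_cf_unique:
  assumes "odd_cf cs" "odd_cf ds" "cf_value cs = cf_value ds"
  shows "cs = ds"
  using assms
proof (induction "length cs" arbitrary: cs ds rule: less_induct)
  case less
  show ?case
  proof (cases "cs = [] \<or> ds = []")
    case True
    then show ?thesis
      using less.prems cf_value_odd_cf(3)[of cs] cf_value_odd_cf(3)[of ds] by force
  next
    case False
    then obtain e a r f b s where cs: "cs = (e, a) # r" and ds: "ds = (f, b) # s"
      by (metis neq_Nil_conv surj_pair)
    have e: "e = 1" "f = 1" and odd: "odd a" "odd b"
      using less.prems odd_cf_Cons cs ds by auto
    have pos: "cf_value cs > 0" using cf_value_odd_cf(3)[of cs] less.prems False by auto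
    have eq: "a + cf_value r = b + cf_value s"
      using less.prems(3) pos unfolding cs ds e
      by (auto simp: field_simps)
    have r: "- 1 < cf_value r" "cf_value r \<le> 1"
      using less.prems(1)[unfolded cs] by (cases rule: odd_cf_tail; simp)+
    have s: "- 1 < cf_value s" "cf_value s \<le> 1"
      using less.prems(2)[unfolded ds] by (cases rule: odd_cf_tail; simp)+
    have "a < b + 2" "b < a + 2" using eq r s by linarith+
    then have ab: "a = b" using odd by presburger
    then have v: "cf_value r = cf_value s" using eq by simp
    have "r = s"
      using less.prems(1)[unfolded cs]
    proof (cases rule: odd_cf_tail)
      case r: 1
      show ?thesis
        using less.prems(2)[unfolded ds]
      proof (cases rule: odd_cf_tail)
        case 1
        then show ?thesis using less.hyps[of r s] r v cs by auto
      next
        case 2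
        \<comment> \<open>The common value is both nonnegative and nonpositive, so it is 0 and both
          tails are empty.\<close>
        then show ?thesis using r v by force
      qed
    next
      case r: 2
      show ?thesis
        using less.prems(2)[unfolded ds]
      proof (cases rule: odd_cf_tail)
        case 1
        then show ?thesis using r v by force
      next
        case 2
        then have "flip_hd r = flip_hd s"
          using less.hyps[of "flip_hd r" "flip_hd s"] r v cs by auto
        then show ?thesis by (metis flip_hd_flip_hd)
      qed
    qed
    then show ?thesis using cs ds e ab by simp
  qed
qed

lemma S0_cf_value:
  assumes "odd_cf cs"
  shows "S0 (cf_value cs) = sum_list (map snd cs)"
proof -
  have "odd_cf_of (cf_value cs) = cs"
    unfolding odd_cf_of_def by (rule the_equality) (use assms odd_cf_unique in auto)
  then show ?thesis by (simp add: S0_def)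
qed

text \<open>Adding 2 to the first partial quotient preserves its parity and its lower bounds, and
  adds 2 to the reciprocal of the value.\<close>

lemma odd_cf_incr:
  assumes "odd_cf cs" "0 < cf_value cs"
  obtains ds where "odd_cf ds" "cf_value ds = cf_value cs / (1 + 2 * cf_value cs)"
    "sum_list (map snd ds) = 2 + sum_list (map snd cs)"
proof -
  obtain e a r where cs: "cs = (e, a) # r"
    using assms(2) by (cases cs rule: flip_hd.cases) auto
  have e: "e = 1" using assms(1) cs odd_cf_Cons by auto
  have "a + cf_value r > 0" using assms(2) by (simp add: cs e)
  then have v: "cf_value ((1, a + 2) # r) = cf_value cs / (1 + 2 * cf_value cs)"
    by (simp add: cs e field_simps)
  have "odd_cf ((1, a + 2) # r)" using assms(1) by (auto simp: cs odd_cf_Cons)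
  then show ?thesis using that v cs by simp
qed

text \<open>Strong induction on the denominator: away from 0 and 1, \<open>p / q\<close> is the
  image of \<open>p / (q - 2 * p)\<close>, \<open>(3 * p - q) / p\<close> or
  \<open>(q - p) / p\<close> under one of the three maps, and each of these has a smaller
  denominator. Fractions need not be reduced.\<close>

lemma odd_cf_exists:
  assumes "x \<in> \<rat>" "0 \<le> x" "x \<le> 1"
  obtains cs where "odd_cf cs" "cf_value cs = x"
proof -
  have "\<exists>cs. odd_cf cs \<and> cf_value cs = real p / real q" if "p \<le> q" "q > 0" for p q :: nat
    using that
  proof (induction q arbitrary: p rule: less_induct)
    case (less q)
    consider "p = 0" | "p > 0" "3 * p \<le> q" | "q < 3 * p" "2 * p < q" | "q \<le> 2 * p" "p < q" | "p = q"
      using less.prems by linarith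
    then show ?case
    proof cases
      case 1
      then show ?thesis by (intro exI[of _ "[]"]) simp
    next
      case 2
      define v where "v = real p / real (q - 2 * p)"
      have v: "v = real p / (real q - 2 * real p)" and pos: "real q - 2 * real p > 0"
        using 2 by (simp_all add: v_def of_nat_diff)
      have "q - 2 * p < q" "p \<le> q - 2 * p" "q - 2 * p > 0" using 2 by linarith+
      then obtain cs where cs: "odd_cf cs" "cf_value cs = v"
        using less.IH unfolding v_def by blast
      have "v > 0" using v pos 2 by simp
      then obtain ds where "odd_cf ds" "cf_value ds = v / (1 + 2 * v)"
        using odd_cf_incr[OF cs(1)] cs(2) by metis
      moreover have "v / (1 + 2 * v) = real p / real q"
        using pos 2 unfolding v by (simp add: field_simps)
      ultimately show ?thesis by metis
    next
      case 3
      then have "p < q" "3 * p - q \<le> p" "p > 0" by linarith+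
      then obtain cs where cs: "odd_cf cs" "cf_value cs = real (3 * p - q) / real p"
        using less.IH by blast
      have v: "cf_value cs = 3 - real q / real p"
        using 3 by (simp add: cs of_nat_diff field_simps)
      \<comment> \<open>This puts the value below 1 and so rules out \<open>[(1, 1)]\<close>, whose
        flipped form may not follow the quotient 3.\<close>
      moreover have "real q / real p > 2" using 3 by (simp add: field_simps)
      ultimately have "cs \<noteq> [(1, 1)]" by auto
      then have "flip_hd cs \<noteq> [(- 1, 1)]" by (cases cs rule: flip_hd.cases) auto
      then have "odd_cf ((1, 3) # flip_hd cs)" using cs by (simp add: odd_cf_Cons)
      moreover have "cf_value ((1, 3) # flip_hd cs) = real p / real q" using v 3 by simp
      ultimately show ?thesis by blast
    next
      case 4
      then have "q - p \<le> p" "p > 0" by linarith+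
      then obtain cs where cs: "odd_cf cs" "cf_value cs = real (q - p) / real p"
        using less.IH 4 by blast
      have "cf_value ((1, 1) # cs) = real p / real q"
        using 4 by (simp add: cs of_nat_diff field_simps)
      moreover have "odd_cf ((1, 1) # cs)" using cs by (simp add: odd_cf_Cons)
      ultimately show ?thesis by blast
    next
      \<comment> \<open>Here \<open>(q - p) / p\<close> would have the same denominator, so the
        value 1 is expanded directly.\<close>
      case 5
      then show ?thesis using less.prems
        by (intro exI[of _ "[(1, 1)]"]) (simp add: odd_cf_Cons)
    qed
  qed
  moreover obtain p q :: nat where "q \<noteq> 0" "\<bar>x\<bar> = real p / real q"
    using Rats_abs_nat_div_natE[OF assms(1)] by metis
  ultimately show ?thesis using that assms by (auto simp: divide_le_eq)
qed

section \<open>Values of \<open>S0\<close> and the three branch maps\<close>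

lemma S0_zero: "S0 0 = 0"
  using S0_cf_value[of "[]"] by simp

text \<open>The numeral in the name of each branch is the amount by which it raises
  \<open>S0\<close>. The form \<open>x / (1 + 2 * x)\<close> of \<open>1 / (2 + 1 / x)\<close> also
  gives the intended value 0 at 0.\<close>

definition branch2 :: "real \<Rightarrow> real" where
  "branch2 x = x / (1 + 2 * x)"

definition branch1 :: "real \<Rightarrow> real" where
  "branch1 x = 1 / (1 + x)"

definition branch3 :: "real \<Rightarrow> real" where
  "branch3 x = 1 / (3 - x)"

text \<open>The point 0 is excluded: its empty expansion has no first quotient to enlarge, and
  \<open>branch2\<close> fixes it.\<close>

lemma S0_branch2:
  assumes "x \<in> \<rat>" "0 < x" "x \<le> 1"
  shows "S0 (branch2 x) = S0 x + 2"
proof -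
  obtain cs where cs: "odd_cf cs" "cf_value cs = x" using odd_cf_exists[OF assms(1)] assms less_imp_le by metis
  obtain ds where "odd_cf ds" "cf_value ds = branch2 x"
    "sum_list (map snd ds) = 2 + sum_list (map snd cs)"
    using odd_cf_incr[OF cs(1)] cs assms unfolding branch2_def by metis
  then show ?thesis using S0_cf_value[of ds] S0_cf_value[of cs] cs by simp
qed

lemma S0_branch1:
  assumes "x \<in> \<rat>" "0 \<le> x" "x \<le> 1"
  shows "S0 (branch1 x) = S0 x + 1"
proof -
  obtain cs where cs: "odd_cf cs" "cf_value cs = x" using odd_cf_exists[OF assms(1)] assms less_imp_le by metis
  have "odd_cf ((1, 1) # cs)" "cf_value ((1, 1) # cs) = branch1 x"
    using cs by (simp_all add: odd_cf_Cons branch1_def)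
  then show ?thesis using S0_cf_value[of "(1, 1) # cs"] S0_cf_value[of cs] cs by simp
qed

text \<open>The expansion is prefixed by the quotient 3 and the old leading sign is flipped. This
  fails at 1, where the flipped tail is the forbidden \<open>[(-1, 1)]\<close>; indeed
  \<open>branch3 1 = 1 / 2\<close> has the expansion \<open>[(1, 1), (1, 1)]\<close> and
  \<open>S0\<close> equal to 2.\<close>

lemma S0_branch3:
  assumes "x \<in> \<rat>" "0 < x" "x < 1"
  shows "S0 (branch3 x) = S0 x + 3"
proof -
  obtain cs where cs: "odd_cf cs" "cf_value cs = x" using odd_cf_exists[OF assms(1)] assms less_imp_le by metis
  have "cs \<noteq> [(1, 1)]" using cs assms by auto
  then have "flip_hd cs \<noteq> [(- 1, 1)]" by (cases cs rule: flip_hd.cases) auto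
  then have "odd_cf ((1, 3) # flip_hd cs)" "cf_value ((1, 3) # flip_hd cs) = branch3 x"
    using cs by (simp_all add: odd_cf_Cons branch3_def)
  then show ?thesis using S0_cf_value[of "(1, 3) # flip_hd cs"] S0_cf_value[of cs] cs by simp
qed

lemma branch_Rats:
  assumes "x \<in> \<rat>"
  shows "branch1 x \<in> \<rat>" "branch2 x \<in> \<rat>" "branch3 x \<in> \<rat>"
  using assms by (auto simp: branch1_def branch2_def branch3_def)

lemma branch2_le_iff:
  assumes "0 \<le> x" "0 \<le> y"
  shows "branch2 x \<le> branch2 y \<longleftrightarrow> x \<le> y"
proof -
  have "1 + 2 * x > 0" "1 + 2 * y > 0" using assms by auto
  then show ?thesis by (simp add: branch2_def field_simps)
qed

lemma branch1_le_iff: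
  assumes "0 \<le> x" "0 \<le> y"
  shows "branch1 x \<le> branch1 y \<longleftrightarrow> y \<le> x"
proof -
  have "1 + x > 0" "1 + y > 0" using assms by auto
  then show ?thesis by (simp add: branch1_def field_simps)
qed

lemma branch3_le_iff:
  assumes "x < 3" "y < 3"
  shows "branch3 x \<le> branch3 y \<longleftrightarrow> x \<le> y"
proof -
  have "3 - x > 0" "3 - y > 0" using assms by auto
  then show ?thesis by (simp add: branch3_def field_simps)
qed

lemma branch_endpoints:
  "branch2 0 = 0" "branch2 1 = 1 / 3" "branch1 0 = 1" "branch1 1 = 1 / 2"
  "branch3 0 = 1 / 3" "branch3 1 = 1 / 2"
  by (simp_all add: branch1_def branch2_def branch3_def)

lemma inj_on_branch2: "inj_on branch2 {0..}"
  by (rule inj_onI) (metis atLeast_iff branch2_le_iff order_antisym order_refl)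

lemma inj_on_branch1: "inj_on branch1 {0..}"
  by (rule inj_onI) (metis atLeast_iff branch1_le_iff order_antisym order_refl)

lemma inj_on_branch3: "inj_on branch3 {..<3}"
  by (rule inj_onI) (metis lessThan_iff branch3_le_iff order_antisym order_refl)

lemma branch2_surj:
  assumes "0 \<le> y" "y \<le> 1 / 3"
  obtains x where "y = branch2 x" "0 \<le> x" "x \<le> 1" "y \<in> \<rat> \<Longrightarrow> x \<in> \<rat>"
proof
  have p: "1 - 2 * y > 0" using assms by simp
  have "1 + 2 * (y / (1 - 2 * y)) = 1 / (1 - 2 * y)" using p by (simp add: field_simps)
  then show "y = branch2 (y / (1 - 2 * y))" using p by (simp add: branch2_def)
  show "0 \<le> y / (1 - 2 * y)" "y / (1 - 2 * y) \<le> 1" "y \<in> \<rat> \<Longrightarrow> y / (1 - 2 * y) \<in> \<rat>"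
    using p assms by (simp_all add: divide_le_eq)
qed

lemma branch1_surj:
  assumes "1 / 2 \<le> y" "y \<le> 1"
  obtains x where "y = branch1 x" "0 \<le> x" "x \<le> 1" "y \<in> \<rat> \<Longrightarrow> x \<in> \<rat>"
proof
  have p: "y > 0" using assms by simp
  show "y = branch1 (1 / y - 1)" by (simp add: branch1_def)
  show "0 \<le> 1 / y - 1" "1 / y - 1 \<le> 1" "y \<in> \<rat> \<Longrightarrow> 1 / y - 1 \<in> \<rat>"
    using p assms by (simp_all add: field_simps)
qed

lemma branch3_surj:
  assumes "1 / 3 < y" "y < 1 / 2"
  obtains x where "y = branch3 x" "0 < x" "x < 1" "y \<in> \<rat> \<Longrightarrow> x \<in> \<rat>"
proof
  have p: "y > 0" using assms by simp
  show "y = branch3 (3 - 1 / y)" by (simp add: branch3_def)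
  show "0 < 3 - 1 / y" "3 - 1 / y < 1" "y \<in> \<rat> \<Longrightarrow> 3 - 1 / y \<in> \<rat>"
    using p assms by (simp_all add: field_simps)
qed

section \<open>Counting points\<close>

text \<open>The point 0 is left out because \<open>branch2\<close> fixes it without raising
  \<open>S0\<close>; it is added back when \<open>F0_seq\<close> is expressed through these
  counts.\<close>

definition odd_points :: "nat \<Rightarrow> real \<Rightarrow> real set" where
  "odd_points m x = {\<xi> \<in> \<rat>. 0 < \<xi> \<and> \<xi> \<le> x \<and> S0 \<xi> \<le> m}"

definition num_points :: "nat \<Rightarrow> real \<Rightarrow> nat" where
  "num_points m x = card (odd_points m x)"

lemma odd_pointsD:
  assumes "\<xi> \<in> odd_points m x"
  shows "\<xi> \<in> \<rat>" "0 < \<xi>" "0 \<le> \<xi>" "\<xi> \<le> x" "S0 \<xi> \<le> m"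
  using assms by (auto simp: odd_points_def)

lemma odd_points_branch2:
  assumes "0 \<le> x" "x \<le> 1"
  shows "odd_points (m + 2) (branch2 x) = branch2 ` odd_points m x"
proof (intro equalityI subsetI)
  fix y assume y: "y \<in> odd_points (m + 2) (branch2 x)"
  have "branch2 x \<le> 1 / 3" using branch2_le_iff[of x 1] assms branch_endpoints by auto
  then have "y \<le> 1 / 3" using odd_pointsD(4)[OF y] by linarith
  then obtain z where z: "y = branch2 z" "0 \<le> z" "z \<le> 1" "z \<in> \<rat>"
    using branch2_surj[of y] odd_pointsD[OF y] by metis
  have "z \<noteq> 0" using y z branch_endpoints by (auto simp: odd_points_def)
  then show "y \<in> branch2 ` odd_points m x"
    using y z S0_branch2[of z] branch2_le_iff[of z x] assms by (auto simp: odd_points_def)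
next
  fix y assume "y \<in> branch2 ` odd_points m x"
  then obtain z where z: "y = branch2 z" "0 < z" "z \<le> x" "z \<in> \<rat>" "S0 z \<le> m"
    by (auto simp: odd_points_def)
  then have "branch2 z > 0" by (simp add: branch2_def)
  then show "y \<in> odd_points (m + 2) (branch2 x)"
    using z S0_branch2[of z] branch2_le_iff[of z x] assms branch_Rats
    by (auto simp: odd_points_def)
qed

text \<open>The map is decreasing, so points up to \<open>x\<close> become points from
  \<open>branch1 x\<close> upwards. The extra point 0 is sent to 1.\<close>

lemma odd_points_branch1:
  assumes "0 \<le> x" "x \<le> 1"
  shows "{y \<in> odd_points (m + 1) 1. branch1 x \<le> y} = branch1 ` insert 0 (odd_points m x)"
proof (intro equalityI subsetI)
  fix y assume y: "y \<in> {y \<in> odd_points (m + 1) 1. branch1 x \<le> y}"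
  have "1 / 2 \<le> branch1 x" using branch1_le_iff[of 1 x] assms branch_endpoints by auto
  then have "1 / 2 \<le> y" "y \<le> 1" "y \<in> \<rat>" using y by (auto simp: odd_points_def)
  then obtain z where z: "y = branch1 z" "0 \<le> z" "z \<le> 1" "z \<in> \<rat>"
    using branch1_surj[of y] by metis
  then show "y \<in> branch1 ` insert 0 (odd_points m x)"
    using y S0_branch1[of z] branch1_le_iff[of x z] assms by (cases "z = 0") (auto simp: odd_points_def)
next
  fix y assume "y \<in> branch1 ` insert 0 (odd_points m x)"
  then obtain z where z: "y = branch1 z" "0 \<le> z" "z \<le> x" "z \<in> \<rat>" "S0 z \<le> m"
    using assms by (auto simp: odd_points_def S0_zero)
  then have "branch1 z > 0" "branch1 z \<le> 1" by (simp_all add: branch1_def)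
  then show "y \<in> {y \<in> odd_points (m + 1) 1. branch1 x \<le> y}"
    using z S0_branch1[of z] branch1_le_iff[of x z] assms branch_Rats
    by (auto simp: odd_points_def)
qed

text \<open>The interval is open because 1/3 and 1/2 are already images under \<open>branch2\<close>
  and \<open>branch1\<close>. Accordingly 1, which would be sent to 1/2, is removed.\<close>

lemma odd_points_branch3:
  assumes "0 \<le> x" "x \<le> 1"
  shows "{y \<in> odd_points (m + 3) (branch3 x). 1 / 3 < y \<and> y < 1 / 2} =
    branch3 ` (odd_points m x - {1})"
proof (intro equalityI subsetI)
  fix y assume y: "y \<in> {y \<in> odd_points (m + 3) (branch3 x). 1 / 3 < y \<and> y < 1 / 2}"
  then have "1 / 3 < y" "y < 1 / 2" "y \<in> \<rat>" by (auto simp: odd_points_def)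
  then obtain z where z: "y = branch3 z" "0 < z" "z < 1" "z \<in> \<rat>"
    using branch3_surj[of y] by metis
  then show "y \<in> branch3 ` (odd_points m x - {1})"
    using y S0_branch3[of z] branch3_le_iff[of z x] assms by (auto simp: odd_points_def)
next
  fix y assume "y \<in> branch3 ` (odd_points m x - {1})"
  then obtain z where z: "y = branch3 z" "0 < z" "z \<le> x" "z < 1" "z \<in> \<rat>" "S0 z \<le> m"
    using assms by (force simp: odd_points_def)
  then have "1 / 3 < y" "y < 1 / 2"
    using branch3_le_iff[of z 0] branch3_le_iff[of 1 z] branch_endpoints by auto
  then show "y \<in> {y \<in> odd_points (m + 3) (branch3 x). 1 / 3 < y \<and> y < 1 / 2}"
    using z S0_branch3[of z] branch3_le_iff[of z x] assms branch_Rats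
    by (auto simp: odd_points_def)
qed

text \<open>Every positive point is a branch image and each branch raises \<open>S0\<close> by at
  least 1. Hence level 0 is empty, and level \<open>Suc m\<close> is covered by three images of
  level \<open>m\<close> with 0 added for \<open>branch1\<close>.\<close>

lemma finite_odd_points_1: "finite (odd_points m 1)"
proof (induction m)
  case 0
  have "S0 y \<noteq> 0" if y: "y \<in> \<rat>" "0 < y" "y \<le> 1" for y
  proof -
    consider "y \<le> 1 / 3" | "1 / 3 < y" "y < 1 / 2" | "1 / 2 \<le> y" by linarith
    then show ?thesis
    proof cases
      case 1
      then obtain z where z: "y = branch2 z" "0 \<le> z" "z \<le> 1" "z \<in> \<rat>"
        using branch2_surj[of y] y less_imp_le by metis
      then show ?thesis using S0_branch2[of z] y branch_endpoints by (cases "z = 0") auto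
    next
      case 2
      then obtain z where z: "y = branch3 z" "0 < z" "z < 1" "z \<in> \<rat>"
        using branch3_surj[of y] y less_imp_le by metis
      then show ?thesis using S0_branch3[of z] by auto
    next
      case 3
      then obtain z where z: "y = branch1 z" "0 \<le> z" "z \<le> 1" "z \<in> \<rat>"
        using branch1_surj[of y] y less_imp_le by metis
      then show ?thesis using S0_branch1[of z] by auto
    qed
  qed
  then have "odd_points 0 1 = {}" by (auto simp: odd_points_def)
  then show ?case by simp
next
  case (Suc m)
  have "odd_points (Suc m) 1 \<subseteq> branch1 ` insert 0 (odd_points m 1) \<union>
    branch2 ` odd_points m 1 \<union> branch3 ` odd_points m 1"
  proof
    fix y assume "y \<in> odd_points (Suc m) 1"
    then have y: "y \<in> \<rat>" "0 < y" "y \<le> 1" "S0 y \<le> Suc m" by (auto simp: odd_points_def)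
    consider "y \<le> 1 / 3" | "1 / 3 < y" "y < 1 / 2" | "1 / 2 \<le> y" by linarith
    then show "y \<in> branch1 ` insert 0 (odd_points m 1) \<union>
      branch2 ` odd_points m 1 \<union> branch3 ` odd_points m 1"
    proof cases
      case 1
      then obtain z where z: "y = branch2 z" "0 \<le> z" "z \<le> 1" "z \<in> \<rat>"
        using branch2_surj[of y] y less_imp_le by metis
      then have "z > 0" using y branch_endpoints by (cases "z = 0") auto
      then show ?thesis using S0_branch2[of z] z y by (auto simp: odd_points_def)
    next
      case 2
      then obtain z where z: "y = branch3 z" "0 < z" "z < 1" "z \<in> \<rat>"
        using branch3_surj[of y] y less_imp_le by metis
      then show ?thesis using S0_branch3[of z] y by (auto simp: odd_points_def)
    next
      case 3
      then obtain z where z: "y = branch1 z" "0 \<le> z" "z \<le> 1" "z \<in> \<rat>"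
        using branch1_surj[of y] y less_imp_le by metis
      then show ?thesis using S0_branch1[of z] y by (cases "z = 0") (auto simp: odd_points_def)
    qed
  qed
  then show ?case by (rule finite_subset) (use Suc in auto)
qed

lemma odd_points_mono: "x \<le> y \<Longrightarrow> odd_points m x \<subseteq> odd_points m y"
  by (auto simp: odd_points_def)

lemma finite_odd_points: "x \<le> 1 \<Longrightarrow> finite (odd_points m x)"
  by (rule finite_subset[OF odd_points_mono finite_odd_points_1])

lemma num_points_mono: "x \<le> y \<Longrightarrow> y \<le> 1 \<Longrightarrow> num_points m x \<le> num_points m y"
  unfolding num_points_def by (intro card_mono finite_odd_points odd_points_mono)

lemma num_points_branch2:
  assumes "0 \<le> x" "x \<le> 1"
  shows "num_points (m + 2) (branch2 x) = num_points m x"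
  unfolding num_points_def odd_points_branch2[OF assms]
  by (intro card_image inj_on_subset[OF inj_on_branch2]) (auto simp: odd_points_def)

lemma card_ge_branch1:
  assumes "0 \<le> x" "x \<le> 1"
  shows "card {y \<in> odd_points (m + 1) 1. branch1 x \<le> y} = num_points m x + 1"
proof -
  have "card (branch1 ` insert 0 (odd_points m x)) = card (insert 0 (odd_points m x))"
    by (intro card_image inj_on_subset[OF inj_on_branch1]) (auto simp: odd_points_def)
  also have "\<dots> = num_points m x + 1"
    unfolding num_points_def
    using finite_odd_points[OF assms(2)] by (subst card_insert_disjoint) (auto simp: odd_points_def)
  finally show ?thesis by (simp only: odd_points_branch1[OF assms])
qed

text \<open>Counting the points on both sides of \<open>branch1 x\<close> counts this point twice
  if it belongs to the set; this is the error term.\<close>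

lemma num_points_branch1:
  assumes "0 \<le> x" "x \<le> 1"
  shows "\<bar>real (num_points (m + 1) (branch1 x)) -
    (real (num_points (m + 1) 1) - real (num_points m x))\<bar> \<le> 1"
proof -
  let ?A = "odd_points (m + 1) (branch1 x)" and ?B = "{y \<in> odd_points (m + 1) 1. branch1 x \<le> y}"
  have le: "branch1 x \<le> 1" using branch1_le_iff[of x 0] assms branch_endpoints by auto
  have fin: "finite ?A" "finite ?B" using finite_odd_points le by auto
  have "odd_points (m + 1) 1 = ?A \<union> ?B" using le by (auto simp: odd_points_def)
  then have "card (odd_points (m + 1) 1) + card (?A \<inter> ?B) = card ?A + card ?B"
    using card_Un_Int[OF fin] by simp
  moreover have "card (?A \<inter> ?B) \<le> card {branch1 x}"
    by (rule card_mono) (auto simp: odd_points_def)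
  ultimately show ?thesis
    using card_ge_branch1[OF assms, of m] by (simp add: num_points_def)
qed

lemma card_image_branch3:
  assumes "0 \<le> x" "x \<le> 1"
  shows "card {y \<in> odd_points (m + 3) (branch3 x). 1 / 3 < y \<and> y < 1 / 2} =
    card (odd_points m x - {1})"
  unfolding odd_points_branch3[OF assms]
  by (intro card_image inj_on_subset[OF inj_on_branch3]) (use assms in \<open>auto simp: odd_points_def\<close>)

lemma num_points_third: "num_points (m + 3) (1 / 3) = num_points (m + 1) 1"
  using num_points_branch2[of 1 "m + 1"] branch_endpoints by (simp add: numeral_eq_Suc)

text \<open>The count is split at 1/3: below lies the whole image of \<open>branch2\<close>, above
  it the image of \<open>branch3\<close>. Since \<open>x < 1\<close>, the exceptional point 1 does
  not occur.\<close>

lemma num_points_branch3: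
  assumes "0 \<le> x" "x < 1"
  shows "num_points (m + 3) (branch3 x) = num_points (m + 1) 1 + num_points m x"
proof -
  let ?A = "odd_points (m + 3) (1 / 3)"
    and ?B = "{y \<in> odd_points (m + 3) (branch3 x). 1 / 3 < y \<and> y < 1 / 2}"
  have le: "1 / 3 \<le> branch3 x" "branch3 x < 1 / 2"
    using branch3_le_iff[of 0 x] branch3_le_iff[of 1 x] assms branch_endpoints by auto
  have fin: "finite ?A" "finite ?B" using finite_odd_points le by auto
  have un: "odd_points (m + 3) (branch3 x) = ?A \<union> ?B" using le by (auto simp: odd_points_def)
  have "card (odd_points (m + 3) (branch3 x)) = card ?A + card ?B"
    by (subst un) (intro card_Un_disjoint fin; auto simp: odd_points_def)
  also have "odd_points m x - {1} = odd_points m x" using assms by (auto simp: odd_points_def)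
  then have "card ?B = num_points m x"
    using card_image_branch3[of x m] assms by (simp add: num_points_def)
  finally show ?thesis using num_points_third by (simp add: num_points_def)
qed

lemma S0_one: "S0 1 = 1"
  using S0_branch1[of 0] by (simp add: branch_endpoints S0_zero)

text \<open>The unit interval is cut into the three branch images. The point 1 missing from the
  \<open>branch3\<close> part is compensated by the image of 0 in the \<open>branch1\<close> part,
  so the recurrence is homogeneous.\<close>

lemma num_points_rec:
  assumes "m \<ge> 1"
  shows "num_points (m + 3) 1 = num_points (m + 2) 1 + num_points (m + 1) 1 + num_points m 1"
proof -
  let ?A = "odd_points (m + 3) (1 / 3)"
    and ?B = "{y \<in> odd_points (m + 3) (branch3 1). 1 / 3 < y \<and> y < 1 / 2}"
    and ?C = "{y \<in> odd_points (m + 3) 1. branch1 1 \<le> y}"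
  have fin: "finite ?A" "finite ?B" "finite ?C" using finite_odd_points branch_endpoints by auto
  have un: "odd_points (m + 3) 1 = (?A \<union> ?B) \<union> ?C"
    by (auto simp: odd_points_def branch_endpoints)
  have "card (odd_points (m + 3) 1) = card (?A \<union> ?B) + card ?C"
    by (subst un) (intro card_Un_disjoint finite_UnI fin; auto simp: odd_points_def branch_endpoints)
  also have "card (?A \<union> ?B) = card ?A + card ?B"
    by (intro card_Un_disjoint fin; auto simp: odd_points_def)
  also have "card ?B = card (odd_points m 1 - {1})" using card_image_branch3[of 1 m] by simp
  also have "\<dots> = num_points m 1 - 1"
    using assms S0_one by (subst card_Diff_singleton) (auto simp: odd_points_def num_points_def)
  also have "card ?C = num_points (m + 2) 1 + 1"
    using card_ge_branch1[of 1 "m + 2"] by (simp add: numeral_eq_Suc)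
  finally have "num_points (m + 3) 1 =
      num_points (m + 1) 1 + (num_points m 1 - 1) + (num_points (m + 2) 1 + 1)"
    using num_points_third by (simp add: num_points_def)
  \<comment> \<open>As \<open>m \<ge> 1\<close>, the point 1 itself is counted, so the subtraction
    of 1 on naturals is not truncated.\<close>
  moreover have "num_points m 1 > 0"
    using assms S0_one finite_odd_points[of 1 m]
    unfolding num_points_def card_gt_0_iff by (auto simp: odd_points_def intro!: exI[of _ 1])
  ultimately show ?thesis by simp
qed

section \<open>Asymptotics\<close>

text \<open>A root \<open>s\<close> exists by the intermediate value theorem. Dividing the cubic by
  \<open>r - s\<close> leaves a quadratic in \<open>r\<close>; completing the square shows it
  positive as soon as \<open>3 * s > 5\<close>, which is where the bound 5/3 comes from.\<close>

lemma lam_unique_root: "\<exists>!r::real. r ^ 3 - r ^ 2 - r - 1 = 0"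
  and lam_gt: "lam > 5 / 3"
proof -
  let ?f = "\<lambda>r::real. r ^ 3 - r ^ 2 - r - 1"
  have "\<exists>s. 5 / 3 \<le> s \<and> s \<le> 2 \<and> ?f s = 0"
    by (rule IVT') (auto intro!: continuous_intros simp: power3_eq_cube power2_eq_square)
  then obtain s where s: "5 / 3 \<le> s" "?f s = 0" by blast
  have "s \<noteq> 5 / 3"
  proof
    assume "s = 5 / 3"
    show False using s(2) unfolding \<open>s = 5 / 3\<close> by (simp add: power3_eq_cube power2_eq_square)
  qed
  then have s': "s > 5 / 3" using s by simp
  have eq: "r = s" if "?f r = 0" for r
  proof (rule ccontr)
    assume "r \<noteq> s"
    have "(r - s) * (r ^ 2 + r * s + s ^ 2 - (r + s) - 1) = ?f r - ?f s"
      by (simp add: power2_eq_square power3_eq_cube algebra_simps)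
    then have "r ^ 2 + r * s + s ^ 2 - (r + s) - 1 = 0" using that s(2) \<open>r \<noteq> s\<close> by simp
    moreover have "r ^ 2 + r * s + s ^ 2 - (r + s) - 1 =
        (r + (s - 1) / 2) ^ 2 + (3 * s - 5) * (s + 1) / 4"
      by (simp add: power2_eq_square field_simps)
    moreover have "(3 * s - 5) * (s + 1) > 0" using s' by (intro mult_pos_pos) auto
    ultimately show False using zero_le_power2[of "r + (s - 1) / 2"] by linarith
  qed
  show "\<exists>!r. ?f r = 0"
    by (rule ex1I[where a = s]) (fact s(2), fact eq)
  have "lam = s"
    unfolding lam_def by (rule the_equality) (fact s(2), fact eq)
  then show "lam > 5 / 3" using s' by simp
qed

lemma lam_root: "lam ^ 3 - lam ^ 2 - lam - 1 = 0"
  unfolding lam_def by (rule theI') (rule lam_unique_root)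

text \<open>The powers of \<open>r\<close> are the weights of the normalised tribonacci recurrence
  and sum to 1. The last inequality, a consequence of \<open>r ^ 3 < r\<close>, makes the reduced
  recurrence of order two contracting.\<close>

lemma inverse_lam:
  defines "r \<equiv> 1 / lam"
  shows "0 < r" "r < 1" "r + r ^ 2 + r ^ 3 = 1" "r ^ 2 + 2 * r ^ 3 < 1"
proof -
  have l: "lam > 5 / 3" by (rule lam_gt)
  show r: "0 < r" "r < 1" using l by (simp_all add: r_def)
  have r': "r < 3 / 5" using l by (simp add: r_def field_simps)
  show sum: "r + r ^ 2 + r ^ 3 = 1"
  proof -
    have "r + r ^ 2 + r ^ 3 = (lam ^ 2 + lam + 1) / lam ^ 3"
      using l by (simp add: r_def field_simps power2_eq_square power3_eq_cube)
    moreover have "lam ^ 2 + lam + 1 = lam ^ 3" using lam_root by linarith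
    ultimately show ?thesis using l by simp
  qed
  have "r ^ 3 < r" using power_strict_decreasing[of 1 3 r] r by simp
  then show "r ^ 2 + 2 * r ^ 3 < 1" using sum by linarith
qed

text \<open>Two steps of the recurrence gain a factor \<open>p + q < 1\<close>, so
  \<open>v n\<close> is bounded by a constant times \<open>(p + q) ^ (n div 2)\<close>.\<close>

lemma tendsto_0_of_le_weighted:
  fixes v :: "nat \<Rightarrow> real"
  assumes nonneg: "\<And>m. 0 \<le> v m" "0 \<le> p" "0 \<le> q" and "p + q < 1"
    and le: "\<And>m. v (m + 2) \<le> p * v (m + 1) + q * v m"
  shows "v \<longlonglongrightarrow> 0"
proof -
  define M where "M = max (v 0) (v 1)"
  let ?c = "p + q"
  have c: "0 \<le> ?c" "?c < 1" using assms by auto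
  have M: "0 \<le> M" "v 0 \<le> M" "v 1 \<le> M" using nonneg(1)[of 0] by (auto simp: M_def)
  have *: "v (2 * k) \<le> M * ?c ^ k \<and> v (2 * k + 1) \<le> M * ?c ^ k" for k
  proof (induction k)
    case 0
    then show ?case using M by simp
  next
    case (Suc k)
    have "v (2 * Suc k) \<le> p * v (2 * k + 1) + q * v (2 * k)" using le[of "2 * k"] by simp
    also have "\<dots> \<le> p * (M * ?c ^ k) + q * (M * ?c ^ k)"
      using Suc nonneg by (intro add_mono mult_left_mono) auto
    finally have 1: "v (2 * Suc k) \<le> M * ?c ^ Suc k" by (simp add: algebra_simps)
    \<comment> \<open>The next odd term mixes the new even term with the old odd one, so the new
      bound is weakened to the old one.\<close>
    have d: "M * ?c ^ Suc k \<le> M * ?c ^ k"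
      using M(1) c by (intro mult_left_mono power_decreasing) auto
    have "v (2 * Suc k + 1) \<le> p * v (2 * Suc k) + q * v (2 * k + 1)"
      using le[of "2 * k + 1"] by simp
    also have "\<dots> \<le> p * (M * ?c ^ k) + q * (M * ?c ^ k)"
      using Suc nonneg 1 d by (intro add_mono mult_left_mono) auto
    finally have "v (2 * Suc k + 1) \<le> M * ?c ^ Suc k" by (simp add: algebra_simps)
    with 1 show ?case by simp
  qed
  have bound: "v n \<le> M * ?c ^ (n div 2)" for n
  proof (cases "even n")
    case True
    then show ?thesis using *[of "n div 2"] by simp
  next
    case False
    then show ?thesis using *[of "n div 2"] odd_two_times_div_two_succ[of n] by simp
  qed
  have "filterlim (\<lambda>n::nat. n div 2) sequentially sequentially"
    unfolding filterlim_at_top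
  proof
    fix Z :: nat
    show "eventually (\<lambda>n. Z \<le> n div 2) sequentially"
      using eventually_ge_at_top[of "2 * Z"] by eventually_elim simp
  qed
  then have "(\<lambda>n. ?c ^ (n div 2)) \<longlonglongrightarrow> 0"
    using filterlim_compose[OF LIMSEQ_power_zero[of ?c]] c by auto
  then have "(\<lambda>n. M * ?c ^ (n div 2)) \<longlonglongrightarrow> 0" using tendsto_mult_right_zero by blast
  then show ?thesis
    by (rule tendsto_sandwich[rotated 3, OF _ ]) (use nonneg bound in auto)
qed

text \<open>The recurrence conserves \<open>u (m + 2) + (r\<^sup>2 + r\<^sup>3) u (m + 1) + r\<^sup>3 u m\<close>, so the
  deviation from the limit satisfies a contracting recurrence of order two.\<close>

lemma weighted_recurrence_tendsto:
  fixes u :: "nat \<Rightarrow> real"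
  assumes r: "0 < r" "r + r ^ 2 + r ^ 3 = 1" "r ^ 2 + 2 * r ^ 3 < 1"
    and rec: "\<And>m. u (m + 3) = r * u (m + 2) + r ^ 2 * u (m + 1) + r ^ 3 * u m"
  shows "u \<longlonglongrightarrow> (u 2 + (r ^ 2 + r ^ 3) * u 1 + r ^ 3 * u 0) / (1 + r ^ 2 + 2 * r ^ 3)"
proof -
  define J where "J = u 2 + (r ^ 2 + r ^ 3) * u 1 + r ^ 3 * u 0"
  define L where "L = J / (1 + r ^ 2 + 2 * r ^ 3)"
  define p where "p = r ^ 2 + r ^ 3"
  define q where "q = r ^ 3"
  have r': "r = 1 - p" "r ^ 2 = p - q" using r by (auto simp: p_def q_def)
  have inv: "u (m + 2) + p * u (m + 1) + q * u m = J" for m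
  proof (induction m)
    case 0
    then show ?case by (simp add: J_def p_def q_def numeral_2_eq_2)
  next
    case (Suc m)
    have "u (m + 3) = (1 - p) * u (m + 2) + (p - q) * u (m + 1) + q * u m"
      using rec[of m] r' q_def by metis
    with Suc show ?case by (simp add: algebra_simps numeral_3_eq_3)
  qed
  have pq: "0 < p" "0 < q" "p + q < 1"
    using r(1,3) by (simp_all add: p_def q_def add_pos_pos)
  have "L = J / (1 + p + q)" by (simp add: L_def p_def q_def)
  then have "L * (1 + p + q) = J" using pq by simp
  \<comment> \<open>The constant sequence \<open>L\<close> has the same invariant \<open>J\<close>;
    subtracting it makes the relation for \<open>u m - L\<close> homogeneous.\<close>
  then have L: "J = L + p * L + q * L" by (simp add: algebra_simps)
  have eq: "u (m + 2) - L = - p * (u (m + 1) - L) - q * (u m - L)" for m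
    using inv[of m] L by (simp add: algebra_simps)
  have "(\<lambda>m. \<bar>u m - L\<bar>) \<longlonglongrightarrow> 0"
  proof (rule tendsto_0_of_le_weighted)
    fix m
    have "\<bar>u (m + 2) - L\<bar> \<le> \<bar>- p * (u (m + 1) - L)\<bar> + \<bar>q * (u m - L)\<bar>"
      unfolding eq by (rule abs_triangle_ineq4)
    then show "\<bar>u (m + 2) - L\<bar> \<le> p * \<bar>u (m + 1) - L\<bar> + q * \<bar>u m - L\<bar>"
      using pq by (simp add: abs_mult)
  qed (use pq in auto)
  then have "(\<lambda>m. u m - L) \<longlonglongrightarrow> 0" by (rule tendsto_rabs_zero_cancel)
  then have "u \<longlonglongrightarrow> L" by (rule LIM_zero_cancel)
  then show ?thesis unfolding L_def J_def .
qed

section \<open>Normalised counts and their convergence\<close>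

definition density :: "nat \<Rightarrow> real \<Rightarrow> real" where
  "density m x = real (num_points m x) / lam ^ m"

lemma lam_pos: "lam > 0" and lam_nonzero: "lam \<noteq> 0"
  using lam_gt by auto

text \<open>Division by \<open>lam ^ m\<close> turns the tribonacci recurrence into a weighted mean
  of three terms. The limit is positive because it is a positive combination of nonnegative initial
  values, among which \<open>u 0\<close> is positive.\<close>

lemma density_1_tendsto:
  obtains K where "0 < K" "(\<lambda>m. density m 1) \<longlonglongrightarrow> K"
proof -
  define r where "r = 1 / lam"
  note r = inverse_lam[folded r_def]
  \<comment> \<open>The shift by one is needed because \<open>num_points_rec\<close> starts at
    \<open>m = 1\<close>.\<close>
  define u where "u m = density (m + 1) 1" for m
  have "u (m + 3) = r * u (m + 2) + r ^ 2 * u (m + 1) + r ^ 3 * u m" for m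
  proof -
    have "real (num_points (m + 4) 1) = real (num_points (m + 3) 1) +
        real (num_points (m + 2) 1) + real (num_points (m + 1) 1)"
      using num_points_rec[of "m + 1"] by (simp add: numeral_eq_Suc)
    then show ?thesis
      using lam_nonzero
      by (simp add: u_def density_def r_def field_simps power_add numeral_eq_Suc)
  qed
  then have lim: "u \<longlonglongrightarrow> (u 2 + (r ^ 2 + r ^ 3) * u 1 + r ^ 3 * u 0) / (1 + r ^ 2 + 2 * r ^ 3)"
    (is "_ \<longlonglongrightarrow> ?K")
    using r by (intro weighted_recurrence_tendsto)
  have "u m \<ge> 0" for m using lam_pos by (simp add: u_def density_def)
  moreover have "num_points 1 1 > 0"
    using S0_one finite_odd_points[of 1 1]
    unfolding num_points_def card_gt_0_iff by (auto simp: odd_points_def intro!: exI[of _ 1])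
  then have "u 0 > 0" using lam_pos by (simp add: u_def density_def)
  ultimately have "?K > 0"
    using r by (intro divide_pos_pos add_nonneg_pos add_nonneg_nonneg add_pos_nonneg mult_pos_pos) auto
  moreover have "(\<lambda>m. density m 1) \<longlonglongrightarrow> ?K"
    using lim unfolding u_def by (rule LIMSEQ_offset)
  ultimately show ?thesis using that by blast
qed

lemma density_branch2:
  assumes "0 \<le> x" "x \<le> 1"
  shows "density (m + 2) (branch2 x) = density m x / lam ^ 2"
  using num_points_branch2[OF assms] by (simp add: density_def power_add power2_eq_square)

lemma density_branch3:
  assumes "0 \<le> x" "x < 1"
  shows "density (m + 3) (branch3 x) = density (m + 1) 1 / lam ^ 2 + density m x / lam ^ 3"
  using num_points_branch3[OF assms, of m] lam_nonzero
  by (simp add: density_def power_add field_simps power2_eq_square power3_eq_cube)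

text \<open>The point possibly counted twice contributes at most
  \<open>1 / lam ^ (m + 1)\<close>.\<close>

lemma density_branch1:
  assumes "0 \<le> x" "x \<le> 1"
  shows "(\<lambda>m. density (m + 1) (branch1 x) - (density (m + 1) 1 - density m x / lam)) \<longlonglongrightarrow> 0"
proof (rule tendsto_0_le[where K = 1])
  have "(\<lambda>m. (1 / lam) ^ (m + 1)) \<longlonglongrightarrow> 0"
    using inverse_lam by (intro LIMSEQ_ignore_initial_segment LIMSEQ_power_zero) auto
  then show "(\<lambda>m. 1 / lam ^ (m + 1)) \<longlonglongrightarrow> 0" by (simp add: power_one_over)
  have "\<bar>density (m + 1) (branch1 x) - (density (m + 1) 1 - density m x / lam)\<bar> \<le> 1 / lam ^ (m + 1)"
    for m
  proof -
    have "density (m + 1) (branch1 x) - (density (m + 1) 1 - density m x / lam) =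
        (real (num_points (m + 1) (branch1 x)) -
          (real (num_points (m + 1) 1) - real (num_points m x))) / lam ^ (m + 1)"
      using lam_nonzero by (simp add: density_def diff_divide_distrib)
    then show ?thesis
      using num_points_branch1[OF assms, of m] lam_pos
      by (simp add: abs_divide divide_right_mono)
  qed
  then show "eventually (\<lambda>m. norm (density (m + 1) (branch1 x) -
      (density (m + 1) 1 - density m x / lam)) \<le> norm (1 / lam ^ (m + 1)) * 1) sequentially"
    using lam_pos by simp
qed

text \<open>A weakening of convergence that every bounded sequence satisfies for some
  \<open>d\<close>; convergence follows once \<open>d\<close> can be made arbitrarily small.\<close>

definition near_convergent :: "real \<Rightarrow> (nat \<Rightarrow> real) \<Rightarrow> bool" where
  "near_convergent d f \<longleftrightarrow> (\<exists>u. convergent u \<and> (\<forall>m. \<bar>f m - u m\<bar> \<le> d))"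

text \<open>If \<open>u\<close> stays close to \<open>f\<close>, then \<open>w m + s * u m\<close>
  stays close to \<open>g (m + k)\<close>, with the error scaled by the modulus of
  \<open>s\<close>.\<close>

lemma near_convergent_step:
  assumes "near_convergent d f" "convergent w" "\<And>m. g (m + k) = w m + s * f m"
    "\<bar>s\<bar> \<le> r" "0 \<le> d"
  shows "near_convergent (r * d) g"
proof -
  obtain u where u: "convergent u" "\<And>m. \<bar>f m - u m\<bar> \<le> d"
    using assms(1) by (auto simp: near_convergent_def)
  \<comment> \<open>The relation says nothing about the first \<open>k\<close> terms; they are
    copied from \<open>g\<close>, which does not affect convergence.\<close>
  define u' where "u' m = (if m < k then g m else w (m - k) + s * u (m - k))" for m
  have "convergent (\<lambda>m. u' (m + k))"
    unfolding u'_def using u(1) assms(2)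
    by (simp add: convergent_add convergent_mult convergent_const)
  then have "convergent u'" by (simp add: convergent_ignore_initial_segment)
  moreover have "\<bar>g m - u' m\<bar> \<le> r * d" for m
  proof (cases "m < k")
    case True
    then show ?thesis using assms(4,5) by (simp add: u'_def)
  next
    case False
    then have "g m - u' m = s * (f (m - k) - u (m - k))"
      using assms(3)[of "m - k"] by (simp add: u'_def algebra_simps)
    then have "\<bar>g m - u' m\<bar> = \<bar>s\<bar> * \<bar>f (m - k) - u (m - k)\<bar>" by (simp add: abs_mult)
    also have "\<dots> \<le> r * d" using u(2) assms(4) by (intro mult_mono) auto
    finally show ?thesis .
  qed
  ultimately show ?thesis unfolding near_convergent_def by blast
qed

lemma convergent_density_1: "convergent (\<lambda>m. density m 1)"
  using density_1_tendsto convergentI by metis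

text \<open>The three branches cover \<open>[0, 1]\<close> and each contracts the distance to convergent sequences
  by a factor of at least \<open>\<lambda>\<close>.\<close>

lemma near_convergent_density:
  obtains D where "\<And>x j. 0 \<le> x \<Longrightarrow> x \<le> 1 \<Longrightarrow>
    near_convergent ((1 / lam) ^ j * D) (\<lambda>m. density m x)" "0 \<le> D"
proof -
  obtain D where D: "0 < D" "\<And>m. norm (density m 1) \<le> D"
    using convergent_imp_Bseq[OF convergent_density_1] by (auto simp: Bseq_def)
  have "near_convergent ((1 / lam) ^ j * D) (\<lambda>m. density m x)" if "0 \<le> x" "x \<le> 1" for x j
    using that
  proof (induction j arbitrary: x)
    \<comment> \<open>At depth 0 the zero sequence serves: \<open>D\<close> bounds the densities at
      1 and hence, by monotonicity, at every \<open>x\<close>.\<close>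
    case 0
    have "\<bar>density m x\<bar> \<le> D" for m
    proof -
      have "0 \<le> density m x" "density m x \<le> density m 1"
        using num_points_mono[of x 1 m] 0 lam_pos by (auto simp: density_def divide_right_mono)
      then show ?thesis using D(2)[of m] by auto
    qed
    then show ?case
      unfolding near_convergent_def by (intro exI[of _ "\<lambda>_. 0"]) (simp add: convergent_const)
  next
    case (Suc j)
    define r where "r = 1 / lam"
    note r = inverse_lam[folded r_def]
    have pow: "r ^ 2 \<le> r" "r ^ 3 \<le> r"
      using power_decreasing[of 1 2 r] power_decreasing[of 1 3 r] r by auto
    have shift: "convergent (\<lambda>m. density (m + 1) 1)"
      using convergent_density_1 by (subst convergent_ignore_initial_segment)
    have d: "0 \<le> r ^ j * D" using r D by simp
    consider "x \<le> 1 / 3" | "1 / 3 < x" "x < 1 / 2" | "1 / 2 \<le> x" by linarith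
    then have "near_convergent (r * (r ^ j * D)) (\<lambda>m. density m x)"
    proof cases
      case 1
      then obtain z where z: "x = branch2 z" "0 \<le> z" "z \<le> 1"
        using branch2_surj[of x] Suc.prems by metis
      show ?thesis
      proof (rule near_convergent_step[OF Suc.IH[OF z(2,3), folded r_def] _ _ _ d])
        show "density (m + 2) x = 0 + r ^ 2 * density m z" for m
          using density_branch2[OF z(2,3)] by (simp add: z(1) r_def power_divide)
      qed (use r pow in \<open>auto simp: convergent_const\<close>)
    next
      case 2
      then obtain z where z: "x = branch3 z" "0 \<le> z" "z < 1" "z \<le> 1"
        using branch3_surj[of x] less_imp_le by metis
      show ?thesis
      proof (rule near_convergent_step[OF Suc.IH[OF z(2,4), folded r_def] _ _ _ d])
        show "density (m + 3) x = density (m + 1) 1 / lam ^ 2 + r ^ 3 * density m z" for m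
          using density_branch3[OF z(2,3)] by (simp add: z(1) r_def power_divide)
        show "convergent (\<lambda>m. density (m + 1) 1 / lam ^ 2)"
          using convergent_mult[OF shift convergent_const[of "1 / lam ^ 2"]] by simp
      qed (use r pow in auto)
    next
      case 3
      then obtain z where z: "x = branch1 z" "0 \<le> z" "z \<le> 1"
        using branch1_surj[of x] Suc.prems by metis
      \<comment> \<open>The error of the \<open>branch1\<close> relation tends to 0 and is absorbed
        into the convergent summand.\<close>
      define e where "e m = density (m + 1) x - (density (m + 1) 1 - density m z / lam)" for m
      have "convergent e"
        using density_branch1[OF z(2,3)] unfolding e_def z(1) by (rule convergentI)
      show ?thesis
      proof (rule near_convergent_step[OF Suc.IH[OF z(2,3), folded r_def] _ _ _ d])
        show "density (m + 1) x = (density (m + 1) 1 + e m) + (- r) * density m z" for m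
          by (simp add: e_def r_def)
        show "convergent (\<lambda>m. density (m + 1) 1 + e m)"
          using shift \<open>convergent e\<close> by (rule convergent_add)
      qed (use r in auto)
    qed
    then show ?case by (simp add: r_def mult.assoc)
  qed
  then show ?thesis using that D(1) by (metis less_imp_le)
qed

text \<open>Two errors of \<open>e / 4\<close> and the Cauchy property of \<open>u\<close> with
  \<open>e / 2\<close> show that \<open>f\<close> is Cauchy.\<close>

lemma convergent_of_near_convergent:
  assumes "\<And>\<epsilon>. 0 < \<epsilon> \<Longrightarrow> near_convergent \<epsilon> f"
  shows "convergent f"
proof -
  have "Cauchy f"
    unfolding Cauchy_def
  proof (intro allI impI)
    fix e :: real
    assume e: "0 < e"
    obtain u where u: "convergent u" "\<And>m. \<bar>f m - u m\<bar> \<le> e / 4"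
      using assms[of "e / 4"] e by (auto simp: near_convergent_def)
    obtain M where M: "\<And>m n. m \<ge> M \<Longrightarrow> n \<ge> M \<Longrightarrow> dist (u m) (u n) < e / 2"
      using metric_CauchyD[OF convergent_Cauchy[OF u(1)], of "e / 2"] e by auto
    have "dist (f m) (f n) < e" if "m \<ge> M" "n \<ge> M" for m n
      using M[OF that] u(2)[of m] u(2)[of n] unfolding dist_real_def by linarith
    then show "\<exists>M. \<forall>m\<ge>M. \<forall>n\<ge>M. dist (f m) (f n) < e" by blast
  qed
  then show ?thesis by (rule Cauchy_convergent)
qed

lemma near_convergent_mono: "near_convergent d f \<Longrightarrow> d \<le> d' \<Longrightarrow> near_convergent d' f"
  unfolding near_convergent_def by (meson order_trans)

lemma convergent_density:
  assumes "0 \<le> x" "x \<le> 1"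
  shows "convergent (\<lambda>m. density m x)"
proof (rule convergent_of_near_convergent)
  fix \<epsilon> :: real
  assume \<epsilon>: "0 < \<epsilon>"
  obtain D where D: "\<And>j. near_convergent ((1 / lam) ^ j * D) (\<lambda>m. density m x)" "0 \<le> D"
    using near_convergent_density assms by metis
  \<comment> \<open>The depth \<open>j\<close> is free while \<open>D\<close> is fixed, so the
    distance drops below any \<epsilon>.\<close>
  have "(\<lambda>j. (1 / lam) ^ j * D) \<longlonglongrightarrow> 0"
    using inverse_lam by (intro tendsto_mult_left_zero LIMSEQ_power_zero) auto
  then have "eventually (\<lambda>j. (1 / lam) ^ j * D < \<epsilon>) sequentially"
    using \<epsilon> by (rule order_tendstoD)
  then obtain j where "(1 / lam) ^ j * D < \<epsilon>" by (auto simp: eventually_sequentially)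
  then show "near_convergent \<epsilon> (\<lambda>m. density m x)" using D(1) near_convergent_mono less_imp_le by metis
qed

section \<open>The limit distribution function and its functional equations\<close>

lemma F0_seq_eq:
  assumes "0 \<le> x" "x \<le> 1"
  shows "F0_seq n x =
    (density (n + 1) x + (1 / lam) ^ (n + 1)) / (density (n + 1) 1 + (1 / lam) ^ (n + 1))"
proof -
  have card: "card (insert 0 (odd_points (n + 1) z)) = num_points (n + 1) z + 1" if "z \<le> 1" for z
    unfolding num_points_def
    using finite_odd_points[OF that] by (subst card_insert_disjoint) (auto simp: odd_points_def)
  \<comment> \<open>\<open>Y n\<close> has level \<open>n + 1\<close> and contains 0; this point
    accounts for the terms \<open>(1 / lam) ^ (n + 1)\<close>, which vanish in the limit.\<close>
  have Y: "Y n = insert 0 (odd_points (n + 1) 1)"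
    by (auto simp: Y_def odd_points_def S0_zero)
  have Yx: "{\<xi> \<in> Y n. \<xi> \<le> x} = insert 0 (odd_points (n + 1) x)"
    using assms by (auto simp: Y_def odd_points_def S0_zero)
  have div: "real (num_points (n + 1) z + 1) = (density (n + 1) z + (1 / lam) ^ (n + 1)) * lam ^ (n + 1)" for z
    using lam_nonzero by (simp add: density_def field_simps)
  show ?thesis
    unfolding F0_seq_def Yx unfolding Y card[OF assms(2)] card[OF order_refl] div
    using lam_nonzero by simp
qed

text \<open>\<open>K\<close> is the total mass of the unnormalised limit distribution.\<close>

lemma F0_eq_limit_density:
  obtains K where "0 < K" "F0 1 = 1"
    "\<And>x. 0 \<le> x \<Longrightarrow> x \<le> 1 \<Longrightarrow> (\<lambda>m. density m x) \<longlonglongrightarrow> K * F0 x"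
proof -
  obtain K where K: "0 < K" "(\<lambda>m. density m 1) \<longlonglongrightarrow> K" by (rule density_1_tendsto)
  have F: "F0 x = l / K" if "0 \<le> x" "x \<le> 1" "(\<lambda>m. density m x) \<longlonglongrightarrow> l" for x l
  proof -
    have z: "(\<lambda>n. (1 / lam) ^ (n + 1)) \<longlonglongrightarrow> 0"
      using inverse_lam by (intro LIMSEQ_ignore_initial_segment LIMSEQ_power_zero) auto
    have "(\<lambda>n. F0_seq n x) \<longlonglongrightarrow> (l + 0) / (K + 0)"
      unfolding F0_seq_eq[OF that(1,2)]
      using K that(3) by (intro tendsto_divide tendsto_add z LIMSEQ_ignore_initial_segment) auto
    then show ?thesis unfolding F0_def by (simp add: limI)
  qed
  show ?thesis
  proof
    show "0 < K" by (rule K(1))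
    show "F0 1 = 1" using F[of 1 K] K by simp
    fix x :: real
    assume x: "0 \<le> x" "x \<le> 1"
    then obtain l where "(\<lambda>m. density m x) \<longlonglongrightarrow> l"
      using convergent_density convergent_def by blast
    then show "(\<lambda>m. density m x) \<longlonglongrightarrow> K * F0 x" using F[OF x] K by simp
  qed
qed

text \<open>Both sides are limits of the relation \<open>density_branch2\<close>, and the positive
  factor \<open>K\<close> cancels.\<close>

lemma F0_branch2:
  assumes "0 \<le> x" "x \<le> 1"
  shows "F0 (branch2 x) = F0 x / lam ^ 2"
proof -
  obtain K where K: "0 < K"
    "\<And>x. 0 \<le> x \<Longrightarrow> x \<le> 1 \<Longrightarrow> (\<lambda>m. density m x) \<longlonglongrightarrow> K * F0 x"
    using F0_eq_limit_density by metis
  have "0 \<le> branch2 x" "branch2 x \<le> 1"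
    using branch2_le_iff[of 0 x] branch2_le_iff[of x 1] assms branch_endpoints by auto
  from K(2)[OF this] have "(\<lambda>m. density (m + 2) (branch2 x)) \<longlonglongrightarrow> K * F0 (branch2 x)"
    by (rule LIMSEQ_ignore_initial_segment)
  moreover have "(\<lambda>m. density (m + 2) (branch2 x)) \<longlonglongrightarrow> K * F0 x / lam ^ 2"
    unfolding density_branch2[OF assms] using lam_nonzero
    by (intro tendsto_divide K(2) assms tendsto_const) auto
  ultimately have "K * F0 (branch2 x) = K * F0 x / lam ^ 2" by (rule LIMSEQ_unique)
  then have "K * F0 (branch2 x) = K * (F0 x / lam ^ 2)" by simp
  then show ?thesis using K(1) by (metis mult_left_cancel less_irrefl)
qed

text \<open>The limit of the relation in \<open>density_branch1\<close>, whose error vanishes; the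
  constant 1 is \<open>F0 1\<close>.\<close>

lemma F0_branch1:
  assumes "0 \<le> x" "x \<le> 1"
  shows "F0 (branch1 x) = 1 - F0 x / lam"
proof -
  obtain K where K: "0 < K" "F0 1 = 1"
    "\<And>x. 0 \<le> x \<Longrightarrow> x \<le> 1 \<Longrightarrow> (\<lambda>m. density m x) \<longlonglongrightarrow> K * F0 x"
    using F0_eq_limit_density by metis
  have "0 \<le> branch1 x" "branch1 x \<le> 1"
    using branch1_le_iff[of x 0] assms by (auto simp: branch_endpoints branch1_def)
  from K(3)[OF this] have b: "(\<lambda>m. density (m + 1) (branch1 x)) \<longlonglongrightarrow> K * F0 (branch1 x)"
    by (rule LIMSEQ_ignore_initial_segment)
  have "(\<lambda>m. density (m + 1) 1) \<longlonglongrightarrow> K * F0 1"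
    using K(3)[of 1] by (intro LIMSEQ_ignore_initial_segment) auto
  then have "(\<lambda>m. density (m + 1) (branch1 x) - (density (m + 1) 1 - density m x / lam))
      \<longlonglongrightarrow> K * F0 (branch1 x) - (K * F0 1 - K * F0 x / lam)"
    using lam_nonzero by (intro tendsto_diff b tendsto_divide K(3) assms tendsto_const)
  then have "K * F0 (branch1 x) - (K * F0 1 - K * F0 x / lam) = 0"
    using density_branch1[OF assms] LIMSEQ_unique by blast
  then have "K * F0 (branch1 x) = K * (1 - F0 x / lam)" using K(2) by (simp add: algebra_simps)
  then show ?thesis using K(1) by simp
qed

text \<open>The argument on the left is the \<open>k\<close>-fold iterate of \<open>branch2\<close>
  at \<open>x\<close>, and each application contributes a factor \<open>1 / lam ^ 2\<close>.\<close>

lemma F0_branch2_iterated: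
  assumes "0 \<le> x" "x \<le> 1"
  shows "F0 (x / (1 + 2 * real k * x)) = F0 x / lam ^ (2 * k)"
proof (induction k)
  case 0
  then show ?case by simp
next
  case (Suc k)
  let ?y = "x / (1 + 2 * real k * x)"
  have d: "1 + 2 * real k * x > 0" using assms by (intro add_pos_nonneg) auto
  have y: "0 \<le> ?y" "?y \<le> 1"
    using d assms by (auto simp: divide_le_eq intro!: add_increasing2)
  have "1 + 2 * ?y = (1 + 2 * real (Suc k) * x) / (1 + 2 * real k * x)"
    using d by (simp add: field_simps)
  then have "x / (1 + 2 * real (Suc k) * x) = branch2 ?y"
    using d unfolding branch2_def by simp
  then show ?case using F0_branch2[OF y] Suc by (simp add: power_add power2_eq_square)
qed

theorem proposition2:
  fixes x :: real and n :: nat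
  assumes "x \<in> {0..1}" and "n \<ge> 1"
  shows "F0 x / lam ^ (2 * n - 1) = 1 / lam ^ (2 * n - 2) - F0 (1 / (2 * real n - 1 + x)) \<and>
         F0 x / lam ^ (2 * n) = F0 (if x = 0 then 0 else 1 / (2 * real n + 1 / x))"
proof
  have x: "0 \<le> x" "x \<le> 1" using assms(1) by auto
  obtain k where n: "n = Suc k" using assms(2) by (cases n) auto
  have "0 \<le> branch1 x" "branch1 x \<le> 1" using x by (auto simp: branch1_def)
  \<comment> \<open>For the first equation \<open>branch2\<close> is applied \<open>n - 1\<close>
    times to \<open>branch1 x\<close>, which adds \<open>2 * (n - 1)\<close> to the denominator
    \<open>1 + x\<close>.\<close>
  note it = F0_branch2_iterated[OF this, of k]
  have "branch1 x / (1 + 2 * real k * branch1 x) = 1 / (2 * real n - 1 + x)"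
  proof -
    have "1 + 2 * real k * branch1 x = (2 * real n - 1 + x) / (1 + x)"
      using x by (simp add: n branch1_def field_simps)
    then show ?thesis using x by (simp add: branch1_def)
  qed
  then have "F0 (1 / (2 * real n - 1 + x)) = (1 - F0 x / lam) / lam ^ (2 * k)"
    using it F0_branch1[OF x] by simp
  then show "F0 x / lam ^ (2 * n - 1) = 1 / lam ^ (2 * n - 2) - F0 (1 / (2 * real n - 1 + x))"
    by (simp add: n diff_divide_distrib)
  \<comment> \<open>The second equation is the \<open>n\<close>-fold iterate at \<open>x\<close>
    itself; this form also yields 0 at \<open>x = 0\<close>.\<close>
  have "(if x = 0 then 0 else 1 / (2 * real n + 1 / x)) = x / (1 + 2 * real n * x)"
    by (simp add: field_simps)
  then show "F0 x / lam ^ (2 * n) = F0 (if x = 0 then 0 else 1 / (2 * real n + 1 / x))"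
    using F0_branch2_iterated[OF x, of n] by simp
qed

end
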